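(* Let $A=\operatorname{tritoep}(a,b,c)\in\mathbb{C}^{n\times n}$ with $bc\neq 0$. For a unitary matrix $W=[\mathbf{w}_1,\dots,\mathbf{w}_n]\in\mathbb{C}^{n\times n}$ to be admissible for forming an APS factorization $A=WRCR^{-1}W^*$ of $A$, it must satisfy, for each column $i=1,2,\dots,n-1$, the homogeneous equations $$\frac{b}{c}=-\frac{\mathbf{w}_j^*S\mathbf{w}_i}{\mathbf{w}_j^*S^T\mathbf{w}_i}\quad\text{for}\quad i+2\le j\le n.$$
   Context: $\operatorname{tritoep}(a,b,c)$ denotes the $n\times n$ tridiagonal Toeplitz matrix with diagonal entries $a$, subdiagonal entries $b$ and superdiagonal entries $c$. $S\in\mathbb{R}^{n\times n}$ is the upward shift matrix, with ones on the first superdiagonal and zeros elsewhere, so $\operatorname{tritoep}(a,b,c)=aI+cS+bS^T$. For a matrix $A$ with characteristic polynomial $\det(zI-A)=z^n-\sum_{i=0}^{n-1}c_iz^i$, the companion matrix $C$ has ones on the first subdiagonal, last column $(c_0,c_1,\dots,c_{n-1})^T$, and zeros elsewhere. An APS (Arioli-Pták-Strakoš) factorization of $A$ is an expression $A=WRCR^{-1}W^*$ with $W$ unitary, $R$ nonsingular upper triangular, and $C$ the companion matrix of the characteristic polynomial of $A$; a unitary $W$ is admissible for forming such a factorization of $A$ if a factorization of this form with that $W$ exists for some such $R$.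
   Formalization: The quotient can be 0/0 (e.g. n = 3, W = I, which is admissible), so the equations are stated as b w_j^*S^T w_i = -c w_j^*S w_i for all pairs, with the quotient form asserted whenever w_j^*S^T w_i is nonzero. *)

theory Defs
  imports Complex_Main
    "Jordan_Normal_Form.Char_Poly"
    "Jordan_Normal_Form.Schur_Decomposition"
begin

(* Matrices and vectors are 0-indexed throughout. *)

definition shift_mat :: "nat \<Rightarrow> complex mat" where
  "shift_mat n = mat n n (\<lambda>(i, j). if j = i + 1 then 1 else 0)"

definition tritoep :: "nat \<Rightarrow> complex \<Rightarrow> complex \<Rightarrow> complex \<Rightarrow> complex mat" where
  "tritoep n a b c = mat n n (\<lambda>(i, j).
     if i = j then a else if i = j + 1 then b else if j = i + 1 then c else 0)"

lemma tritoep_eq_shift: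
  "tritoep n a b c =
     a \<cdot>\<^sub>m 1\<^sub>m n + c \<cdot>\<^sub>m shift_mat n + b \<cdot>\<^sub>m transpose_mat (shift_mat n)"
  by (rule eq_matI) (auto simp: tritoep_def shift_mat_def)

(* The sign in the last column comes from writing the characteristic polynomial
   as z^n - (\<Sum>i<n. c_i z^i), so that c_i is minus its i-th coefficient. *)
definition companion_mat :: "complex mat \<Rightarrow> complex mat" where
  "companion_mat A = (let n = dim_row A in mat n n (\<lambda>(i, j).
     if j = n - 1 then - coeff (char_poly A) i else if i = j + 1 then 1 else 0))"

definition unitary_mat :: "nat \<Rightarrow> complex mat \<Rightarrow> bool" where
  "unitary_mat n W \<longleftrightarrow> W \<in> carrier_mat n n \<and> mat_adjoint W * W = 1\<^sub>m n"

definition APS_factorization ::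
  "nat \<Rightarrow> complex mat \<Rightarrow> complex mat \<Rightarrow> complex mat \<Rightarrow> bool" where
  "APS_factorization n A W R \<longleftrightarrow>
     unitary_mat n W \<and> R \<in> carrier_mat n n \<and> upper_triangular R \<and>
     (\<exists>R' \<in> carrier_mat n n. inverts_mat R R' \<and> inverts_mat R' R \<and>
        A = W * R * companion_mat A * R' * mat_adjoint W)"

definition APS_admissible :: "nat \<Rightarrow> complex mat \<Rightarrow> complex mat \<Rightarrow> bool" where
  "APS_admissible n A W \<longleftrightarrow> (\<exists>R. APS_factorization n A W R)"

(* sesq M x y is y^* M x; the library's scalar product conjugates its second argument. *)
definition sesq :: "complex mat \<Rightarrow> complex vec \<Rightarrow> complex vec \<Rightarrow> complex" where
  "sesq M x y = (M *\<^sub>v x) \<bullet>c y"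

(* The equation b/c = - (w_j^* S w_i) / (w_j^* S^T w_i) for a pair of columns.
   Both forms on the right may vanish (W the identity gives 0/0), so it is stated
   as the homogeneous linear equation, together with the quotient itself whenever
   its denominator is nonzero. *)
definition APS_ratio_equation ::
  "nat \<Rightarrow> complex \<Rightarrow> complex \<Rightarrow> complex vec \<Rightarrow> complex vec \<Rightarrow> bool" where
  "APS_ratio_equation n b c wi wj \<longleftrightarrow>
     (let p = sesq (shift_mat n) wi wj; q = sesq (transpose_mat (shift_mat n)) wi wj in
        b * q = - (c * p) \<and> (q \<noteq> 0 \<longrightarrow> b / c = - (p / q)))"

end

theory Submission
  imports Defs
begin

text \<open>If \<open>A = W R C R\<^sup>-\<^sup>1 W\<^sup>*\<close>, then \<open>H = W\<^sup>* A W\<close> satisfies \<open>H R = R C\<close>. Away from the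
  last column, \<open>C\<close> shifts the columns of \<open>R\<close>, so induction on the column index shows that \<open>H\<close>
  is upper Hessenberg. The entries of \<open>H\<close> are \<open>w\<^sub>j\<^sup>* A w\<^sub>i\<close>; for \<open>A = a I + c S + b S\<^sup>T\<close>
  the \<open>a\<close> term drops out by orthogonality, and the vanishing of the rest is the claimed equation.\<close>

text \<open>Multiplicativity gives \<open>det R \<noteq> 0\<close>, and a triangular determinant is
  the product of the diagonal.\<close>

lemma upper_triangular_invertible_diag:
  fixes R :: "'a :: field mat"
  assumes R: "R \<in> carrier_mat n n" and R': "R' \<in> carrier_mat n n"
    and tri: "upper_triangular R" and inv: "R * R' = 1\<^sub>m n" and i: "i < n"
  shows "R $$ (i, i) \<noteq> 0"
proof -
  have "det R * det R' = 1"
    using det_mult[OF R R'] inv by simp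
  then have "det R \<noteq> 0" by auto
  then show ?thesis
    using upper_triangular_imp_det_eq_0_iff[OF R tri] R i by (force simp: diag_mat_def)
qed

lemma companion_mat_carrier [simp]:
  "A \<in> carrier_mat n n \<Longrightarrow> companion_mat A \<in> carrier_mat n n"
  by (auto simp: companion_mat_def Let_def)

text \<open>For \<open>i + 1 < n\<close>, column \<open>i\<close> of the companion matrix is the
  unit vector with index \<open>i + 1\<close>; the bound excludes the last column, which holds the
  coefficients.\<close>

lemma mult_companion_mat_index:
  assumes "A \<in> carrier_mat n n" and R: "R \<in> carrier_mat n n"
    and "k < n" "i + 1 < n"
  shows "(R * companion_mat A) $$ (k, i) = R $$ (k, i + 1)"
proof -
  have "(R * companion_mat A) $$ (k, i) =
      (\<Sum>l<n. R $$ (k, l) * (if l = i + 1 then 1 else 0))"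
    using assms by (auto simp: companion_mat_def Let_def scalar_prod_def lessThan_atLeast0 intro!: sum.cong)
  also have "\<dots> = R $$ (k, i + 1)"
    using assms by (simp add: if_distrib cong: if_cong)
  finally show ?thesis .
qed

text \<open>Strong induction on \<open>i\<close> along a fixed row \<open>k\<close>: entry
  \<open>(k, i)\<close> of \<open>eq\<close> reduces to
  \<open>H $$ (k, i) * R $$ (i, i) = R $$ (k, i + 1)\<close>, and the nonzero diagonal entry
  cancels.\<close>

lemma companion_similar_hessenberg:
  assumes A: "A \<in> carrier_mat n n" and R: "R \<in> carrier_mat n n" and H: "H \<in> carrier_mat n n"
    and tri: "upper_triangular R" and diag: "\<And>i. i < n \<Longrightarrow> R $$ (i, i) \<noteq> 0"
    and eq: "H * R = R * companion_mat A"
  shows "i + 2 \<le> k \<Longrightarrow> k < n \<Longrightarrow> H $$ (k, i) = 0"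
proof (induction i rule: less_induct)
  case (less i)
  have "(H * R) $$ (k, i) = (\<Sum>l<n. H $$ (k, l) * R $$ (l, i))"
    using less.prems H R by (simp add: scalar_prod_def lessThan_atLeast0)
  \<comment> \<open>Terms with \<open>l < i\<close> vanish by the induction hypothesis for row
    \<open>k\<close>, terms with \<open>l > i\<close> by triangularity of \<open>R\<close>.\<close>
  also have "\<dots> = (\<Sum>l\<in>{i}. H $$ (k, l) * R $$ (l, i))"
  proof (rule sum.mono_neutral_right)
    show "\<forall>l\<in>{..<n} - {i}. H $$ (k, l) * R $$ (l, i) = 0"
    proof
      fix l assume l: "l \<in> {..<n} - {i}"
      show "H $$ (k, l) * R $$ (l, i) = 0"
      proof (cases "l < i")
        case True
        then show ?thesis using less by simp
      next
        case False
        then show ?thesis using l tri R by (simp add: upper_triangularD)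
      qed
    qed
  qed (use less.prems in auto)
  finally have "H $$ (k, i) * R $$ (i, i) = (R * companion_mat A) $$ (k, i)"
    by (simp add: eq)
  also have "\<dots> = R $$ (k, i + 1)"
    using less.prems by (intro mult_companion_mat_index[OF A R]) auto
  \<comment> \<open>\<open>i + 2 \<le> k\<close> places \<open>(k, i + 1)\<close> strictly below the
    diagonal.\<close>
  also have "\<dots> = 0"
    using less.prems tri R by (intro upper_triangularD) auto
  finally show ?case using diag[of i] less.prems by simp
qed

lemma mat_adjoint_carrier:
  "W \<in> carrier_mat n m \<Longrightarrow> mat_adjoint W \<in> carrier_mat m n"
  by (auto simp: mat_adjoint_def)

lemma adjoint_mult_mult_index:
  assumes W: "W \<in> carrier_mat n n" and M: "M \<in> carrier_mat n n"
    and i: "i < n" and j: "j < n"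
  shows "(mat_adjoint W * M * W) $$ (j, i) = sesq M (col W i) (col W j)"
proof -
  have ad: "mat_adjoint W \<in> carrier_mat n n" by (rule mat_adjoint_carrier[OF W])
  have "mat_adjoint W * M * W = mat_adjoint W * (M * W)"
    using ad M W by (rule assoc_mult_mat)
  moreover have "row (mat_adjoint W) j = conjugate (col W j)"
    using W j by (intro eq_vecI) (auto simp: mat_adjoint_def mat_of_rows_def)
  moreover have "conjugate (col W j) \<bullet> (M *\<^sub>v col W i) = (M *\<^sub>v col W i) \<bullet>c col W j"
    using W M by (intro comm_scalar_prod[of _ n]) auto
  ultimately show ?thesis
    using ad W M i j col_mult2[OF M W i] by (simp add: sesq_def)
qed

lemma smult_mat_mult_vec:
  fixes M :: "'a :: comm_ring_1 mat"
  assumes "M \<in> carrier_mat nr nc" "v \<in> carrier_vec nc"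
  shows "(k \<cdot>\<^sub>m M) *\<^sub>v v = k \<cdot>\<^sub>v (M *\<^sub>v v)"
  using assms by (intro eq_vecI) auto

text \<open>\<open>sesq\<close> is linear in its matrix. The inner product is kept as a separate
  term because it vanishes for distinct columns of a unitary matrix.\<close>

lemma sesq_tritoep:
  assumes x: "x \<in> carrier_vec n" and y: "y \<in> carrier_vec n"
  shows "sesq (tritoep n a b c) x y =
    a * (x \<bullet>c y) + c * sesq (shift_mat n) x y + b * sesq (transpose_mat (shift_mat n)) x y"
proof -
  have S: "shift_mat n \<in> carrier_mat n n" by (simp add: shift_mat_def)
  have cy: "conjugate y \<in> carrier_vec n" using y by simp
  have "tritoep n a b c *\<^sub>v x =
      a \<cdot>\<^sub>v x + c \<cdot>\<^sub>v (shift_mat n *\<^sub>v x) + b \<cdot>\<^sub>v (transpose_mat (shift_mat n) *\<^sub>v x)"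
    using S x by (simp add: tritoep_eq_shift add_mult_distrib_mat_vec[of _ n n] smult_mat_mult_vec[of _ n n])
  then show ?thesis
    using S x cy by (simp add: sesq_def add_scalar_prod_distrib[of _ n]
        smult_scalar_prod_distrib[of _ n])
qed

lemma APS_admissible_hessenberg:
  assumes A: "A \<in> carrier_mat n n" and adm: "APS_admissible n A W"
    and ij: "i + 2 \<le> j" "j < n"
  shows "sesq A (col W i) (col W j) = 0"
proof -
  define V where "V = mat_adjoint W"
  define C where "C = companion_mat A"
  obtain R R' where W: "W \<in> carrier_mat n n" and VW: "V * W = 1\<^sub>m n"
    and R: "R \<in> carrier_mat n n" and tri: "upper_triangular R"
    and R': "R' \<in> carrier_mat n n" and inv: "R * R' = 1\<^sub>m n" "R' * R = 1\<^sub>m n"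
    and fact: "A = W * R * C * R' * V"
    using adm unfolding APS_admissible_def APS_factorization_def unitary_mat_def V_def C_def
    by (auto simp: inverts_mat_def)
  have V: "V \<in> carrier_mat n n" using W unfolding V_def by (rule mat_adjoint_carrier)
  have C: "C \<in> carrier_mat n n" using A unfolding C_def by simp
  define H where "H = V * A * W"
  have H: "H \<in> carrier_mat n n" using V A W by (simp add: H_def)
  \<comment> \<open>Inserting the factorization of \<open>A\<close> produces
    \<open>V * W = 1\<^sub>m n\<close> at both ends.\<close>
  have "H = (V * W) * (R * (C * (R' * (V * W))))"
    using V W R C R' unfolding H_def by (subst fact) (simp add: assoc_mult_mat[of _ n n _ n _ n])
  then have "H = R * (C * R')"
    using VW R C R' by simp
  then have "H * R = R * (C * (R' * R))"
    using R C R' by (simp add: assoc_mult_mat[of _ n n _ n _ n])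
  then have "H * R = R * companion_mat A"
    using inv C R by (simp add: C_def)
  then have "H $$ (j, i) = 0"
    using upper_triangular_invertible_diag[OF R R' tri inv(1)] ij
    by (intro companion_similar_hessenberg[OF A R H tri]) auto
  then show ?thesis
    using adjoint_mult_mult_index[OF W A, of i j] ij by (simp add: H_def V_def)
qed

theorem corollary3p3:
  fixes n :: nat and a b c :: complex and W :: "complex mat"
  assumes "b * c \<noteq> 0"
    and "unitary_mat n W"
    and "APS_admissible n (tritoep n a b c) W"
  shows "\<forall>i < n - 1. \<forall>j. i + 2 \<le> j \<and> j < n \<longrightarrow>
           APS_ratio_equation n b c (col W i) (col W j)"
proof (intro allI impI)
  fix i j assume "i < n - 1" and "i + 2 \<le> j \<and> j < n"
  then have ij: "i + 2 \<le> j" "i < n" "j < n" by auto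
  have W: "W \<in> carrier_mat n n" and VW: "mat_adjoint W * W = 1\<^sub>m n"
    using assms(2) by (auto simp: unitary_mat_def)
  have cols: "col W i \<in> carrier_vec n" "col W j \<in> carrier_vec n"
    using W ij by auto
  let ?p = "sesq (shift_mat n) (col W i) (col W j)"
  let ?q = "sesq (transpose_mat (shift_mat n)) (col W i) (col W j)"
  \<comment> \<open>Taking the identity as the middle matrix in the entry formula turns unitarity
    into orthogonality of columns.\<close>
  have "mat_adjoint W * 1\<^sub>m n * W = 1\<^sub>m n"
    using VW mat_adjoint_carrier[OF W] by simp
  then have "col W i \<bullet>c col W j = 0"
    using adjoint_mult_mult_index[OF W one_carrier_mat, of i j] ij
      one_mult_mat_vec[OF col_carrier_vec[OF _ W], of i]
    by (simp add: sesq_def)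
  moreover have "sesq (tritoep n a b c) (col W i) (col W j) = 0"
    using ij by (intro APS_admissible_hessenberg[OF _ assms(3)]) (auto simp: tritoep_def)
  ultimately have eq: "b * ?q = - (c * ?p)"
    using sesq_tritoep[OF cols, of a b c]
    by (simp add: eq_neg_iff_add_eq_0 add.commute)
  \<comment> \<open>Division by \<open>c\<close> is legitimate since
    \<open>b * c \<noteq> 0\<close>.\<close>
  moreover have "b / c = - (?p / ?q)" if "?q \<noteq> 0"
    using that eq assms(1) by (simp add: field_simps)
  ultimately show "APS_ratio_equation n b c (col W i) (col W j)"
    by (simp add: APS_ratio_equation_def Let_def)
qed

end
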